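(* Let $R$ be a relational structure. There is a monomorphic decomposition of $R$ of which every other monomorphic decomposition of $R$ is a refinement.
   Context: A relational structure is a pair $R=(E,(\rho_i)_{i\in I})$ where $E$ is a set and each $\rho_i$ is an $m_i$-ary relation on $E$ ($I$ may be infinite). The restriction of $R$ to $A\subseteq E$ is $R_{\restriction A}=(A,(A^{m_i}\cap\rho_i)_{i\in I})$. A set partition $(E_x)_{x\in X}$ of $E$ is a monomorphic decomposition of $R$ if, for any two finite subsets $A,A'$ of $E$ such that $|A\cap E_x|=|A'\cap E_x|$ for all $x\in X$, the restrictions $R_{\restriction A}$ and $R_{\restriction A'}$ are isomorphic. A partition $\mathcal Q$ refines a partition $\mathcal P$ if every block of $\mathcal P$ is a union of blocks of $\mathcal Q$. *)

theory Defs
  imports "HOL-Library.Disjoint_Sets"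
begin

text \<open>
  \<open>tuples A n\<close> is $A^n$.  The index set is a field of the structure, so that it may be of any
  size, including empty, independently of the type \<open>'i\<close>; the values of \<open>arity\<close> and \<open>rel\<close> outside
  it carry no meaning.
\<close>

definition tuples :: "'a set \<Rightarrow> nat \<Rightarrow> 'a list set" where
  "tuples A n = {xs. length xs = n \<and> set xs \<subseteq> A}"

record ('a, 'i) rel_struct =
  universe :: "'a set"
  index_set :: "'i set"
  arity :: "'i \<Rightarrow> nat"
  rel :: "'i \<Rightarrow> 'a list set"

definition relational_structure :: "('a, 'i) rel_struct \<Rightarrow> bool" where
  "relational_structure R \<longleftrightarrow>
     (\<forall>i\<in>index_set R. rel R i \<subseteq> tuples (universe R) (arity R i))"

definition restriction :: "('a, 'i) rel_struct \<Rightarrow> 'a set \<Rightarrow> ('a, 'i) rel_struct" where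
  "restriction R A =
     \<lparr>universe = A, index_set = index_set R, arity = arity R,
      rel = (\<lambda>i. tuples A (arity R i) \<inter> rel R i)\<rparr>"

definition isomorphic :: "('a, 'i) rel_struct \<Rightarrow> ('b, 'i) rel_struct \<Rightarrow> bool" where
  "isomorphic R S \<longleftrightarrow>
     index_set R = index_set S \<and>
     (\<forall>i\<in>index_set R. arity R i = arity S i) \<and>
     (\<exists>f. bij_betw f (universe R) (universe S) \<and>
          (\<forall>i\<in>index_set R. \<forall>xs\<in>tuples (universe R) (arity R i).
             xs \<in> rel R i \<longleftrightarrow> map f xs \<in> rel S i))"

text \<open>A partition is given by its set of (nonempty) blocks, as in \<^const>\<open>partition_on\<close>.\<close>

definition monomorphic_decomposition :: "('a, 'i) rel_struct \<Rightarrow> 'a set set \<Rightarrow> bool" where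
  "monomorphic_decomposition R P \<longleftrightarrow>
     partition_on (universe R) P \<and>
     (\<forall>A A'. finite A \<and> A \<subseteq> universe R \<and> finite A' \<and> A' \<subseteq> universe R \<and>
        (\<forall>B\<in>P. card (A \<inter> B) = card (A' \<inter> B)) \<longrightarrow>
        isomorphic (restriction R A) (restriction R A'))"

text \<open>
  The library's \<^const>\<open>refines\<close> asks every block of the finer partition \<open>Q\<close> to lie in a block of
  \<open>P\<close>; it agrees with the definition by unions of blocks.
\<close>

lemma refines_iff_blocks_are_unions:
  assumes "partition_on E Q" "partition_on E P"
  shows "refines E Q P \<longleftrightarrow> (\<forall>B\<in>P. \<exists>\<C>\<subseteq>Q. B = \<Union>\<C>)"
proof
  assume ref: "refines E Q P"
  show "\<forall>B\<in>P. \<exists>\<C>\<subseteq>Q. B = \<Union>\<C>"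
  proof
    fix B assume B: "B \<in> P"
    have "B \<subseteq> \<Union>{C \<in> Q. C \<subseteq> B}"
    proof
      fix x assume x: "x \<in> B"
      then obtain C where C: "C \<in> Q" "x \<in> C"
        using B assms by (auto simp: partition_on_def)
      then obtain B' where B': "B' \<in> P" "C \<subseteq> B'"
        using ref by (auto simp: refines_def)
      then have "B' = B"
        using B x C assms(2) by (auto simp: partition_on_def disjoint_def)
      then show "x \<in> \<Union>{C \<in> Q. C \<subseteq> B}" using B' C by auto
    qed
    then have "B = \<Union>{C \<in> Q. C \<subseteq> B}" by auto
    then show "\<exists>\<C>\<subseteq>Q. B = \<Union>\<C>" by (intro exI[of _ "{C \<in> Q. C \<subseteq> B}"]) auto
  qed
next
  assume un: "\<forall>B\<in>P. \<exists>\<C>\<subseteq>Q. B = \<Union>\<C>"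
  have "\<exists>B\<in>P. C \<subseteq> B" if C: "C \<in> Q" for C
  proof -
    have "C \<noteq> {}" using C assms(1) by (auto simp: partition_on_def)
    then obtain x where x: "x \<in> C" by blast
    then obtain B where B: "B \<in> P" "x \<in> B"
      using C assms by (auto simp: partition_on_def)
    then obtain \<C> where c: "\<C> \<subseteq> Q" "B = \<Union>\<C>" using un by blast
    then obtain D where D: "D \<in> \<C>" "x \<in> D" using B by auto
    then have "D = C"
      using c C x assms(1) by (auto simp: partition_on_def disjoint_def)
    then show ?thesis using B c D by auto
  qed
  then show "refines E Q P" using assms by (auto simp: refines_def)
qed

end

theory Submission
  imports Defs
begin

text \<open>
  Call two points of the universe exchangeable if, whichever finite set of other points they are
  added to, they produce isomorphic restrictions. Two points of a common block of a monomorphic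
  decomposition are exchangeable, since adding the one or the other to a finite set gives the same
  number of points in every block. Hence, once exchangeability is known to be an equivalence
  relation (\<open>equiv_exchangeable\<close>) whose classes form a monomorphic decomposition
  (\<open>exchangeability_classes_monomorphic\<close>), every monomorphic decomposition refines this one.

  That the classes form a monomorphic decomposition is seen by turning \<open>A\<close> into \<open>A'\<close>
  point by point: if both have the same number of points in each class, a point of \<open>A - A'\<close>
  can be exchanged for a point of \<open>A' - A\<close> in the same class, and no exchange alters the
  isomorphism type of the restriction. The one delicate point in the equivalence is transitivity:
  \<open>x\<close> and \<open>z\<close> must also be exchangeable over sets that contain the intermediate point \<open>y\<close>.
\<close>

section \<open>Isomorphism is an equivalence\<close>

lemma map_in_tuples:
  "xs \<in> tuples A n \<Longrightarrow> f ` A \<subseteq> B \<Longrightarrow> map f xs \<in> tuples B n"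
  by (auto simp: tuples_def)

lemma isomorphic_refl: "isomorphic R R"
  unfolding isomorphic_def by (auto intro!: exI[of _ id])

lemma isomorphic_sym:
  assumes "isomorphic R S"
  shows "isomorphic S R"
proof -
  obtain f where ix: "index_set R = index_set S"
    and ar: "\<And>i. i \<in> index_set R \<Longrightarrow> arity R i = arity S i"
    and f: "bij_betw f (universe R) (universe S)"
    and rel: "\<And>i xs. i \<in> index_set R \<Longrightarrow> xs \<in> tuples (universe R) (arity R i) \<Longrightarrow>
                xs \<in> rel R i \<longleftrightarrow> map f xs \<in> rel S i"
    using assms unfolding isomorphic_def by blast
  define g where "g = inv_into (universe R) f"
  have g: "bij_betw g (universe S) (universe R)"
    unfolding g_def by (rule bij_betw_inv_into[OF f])
  have "ys \<in> rel S i \<longleftrightarrow> map g ys \<in> rel R i"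
    if i: "i \<in> index_set R" and ys: "ys \<in> tuples (universe S) (arity R i)" for i ys
  proof -
    have "map g ys \<in> tuples (universe R) (arity R i)"
      using ys g by (auto intro!: map_in_tuples simp: bij_betw_def)
    moreover have "map f (map g ys) = ys"
      using ys f by (auto intro!: map_idI simp: g_def tuples_def bij_betw_inv_into_right)
    ultimately show ?thesis using rel[OF i] by metis
  qed
  then show ?thesis
    using ix ar g unfolding isomorphic_def by auto
qed

lemma isomorphic_trans:
  assumes "isomorphic R S" "isomorphic S T"
  shows "isomorphic R T"
proof -
  obtain f where f: "bij_betw f (universe R) (universe S)"
    and rel_f: "\<And>i xs. i \<in> index_set R \<Longrightarrow> xs \<in> tuples (universe R) (arity R i) \<Longrightarrow>
                  xs \<in> rel R i \<longleftrightarrow> map f xs \<in> rel S i"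
    using assms(1) unfolding isomorphic_def by blast
  obtain g where g: "bij_betw g (universe S) (universe T)"
    and rel_g: "\<And>i xs. i \<in> index_set S \<Longrightarrow> xs \<in> tuples (universe S) (arity S i) \<Longrightarrow>
                  xs \<in> rel S i \<longleftrightarrow> map g xs \<in> rel T i"
    using assms(2) unfolding isomorphic_def by blast
  have ix: "index_set R = index_set S" "index_set S = index_set T"
    and ar: "\<And>i. i \<in> index_set R \<Longrightarrow> arity R i = arity S i \<and> arity S i = arity T i"
    using assms unfolding isomorphic_def by auto
  have "xs \<in> rel R i \<longleftrightarrow> map (g \<circ> f) xs \<in> rel T i"
    if i: "i \<in> index_set R" and xs: "xs \<in> tuples (universe R) (arity R i)" for i xs
  proof -
    have "map f xs \<in> tuples (universe S) (arity S i)"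
      using xs f ar[OF i] by (auto intro!: map_in_tuples simp: bij_betw_def)
    then show ?thesis using rel_f[OF i xs] rel_g i ix by simp
  qed
  then show ?thesis
    using ix ar bij_betw_trans[OF f g] unfolding isomorphic_def by auto
qed

section \<open>Exchangeable points\<close>

definition exchangeable :: "('a, 'i) rel_struct \<Rightarrow> ('a \<times> 'a) set" where
  "exchangeable R = {(x, y). x \<in> universe R \<and> y \<in> universe R \<and>
     (\<forall>F. finite F \<and> F \<subseteq> universe R - {x, y} \<longrightarrow>
        isomorphic (restriction R (insert x F)) (restriction R (insert y F)))}"

lemma exchangeableD:
  assumes "(x, y) \<in> exchangeable R" "finite F" "F \<subseteq> universe R" "x \<notin> F" "y \<notin> F"
  shows "isomorphic (restriction R (insert x F)) (restriction R (insert y F))"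
  using assms unfolding exchangeable_def by auto

text \<open>
  Over a set \<open>F\<close> that contains \<open>y\<close>, with \<open>G = F - {y}\<close>, the chain
  \<open>G \<union> {x, y}\<close>, \<open>G \<union> {x, z}\<close>, \<open>G \<union> {y, z}\<close> links the two restrictions to compare:
  the first step exchanges \<open>y\<close> for \<open>z\<close> and the second exchanges \<open>x\<close> for \<open>y\<close>.
\<close>

lemma exchangeable_trans:
  assumes xy: "(x, y) \<in> exchangeable R" and yz: "(y, z) \<in> exchangeable R"
  shows "(x, z) \<in> exchangeable R"
proof -
  have E: "x \<in> universe R" "y \<in> universe R" "z \<in> universe R"
    using xy yz unfolding exchangeable_def by auto
  have "isomorphic (restriction R (insert x F)) (restriction R (insert z F))"
    if F: "finite F" "F \<subseteq> universe R" "x \<notin> F" "z \<notin> F" for F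
  proof (cases "x = z \<or> y \<notin> F")
    case True
    then show ?thesis
      using exchangeableD[OF xy F(1,2,3)] exchangeableD[OF yz F(1,2) _ F(4)]
      by (auto intro: isomorphic_refl isomorphic_trans)
  next
    case False
    define G where "G = F - {y}"
    have F_eq: "F = insert y G" and G: "finite G" "G \<subseteq> universe R" "y \<notin> G" "x \<notin> G" "z \<notin> G"
      using False F by (auto simp: G_def)
    have ne: "x \<noteq> y" "y \<noteq> z" "x \<noteq> z" using False F by auto
    have "isomorphic (restriction R (insert y (insert x G))) (restriction R (insert z (insert x G)))"
      using G E ne by (intro exchangeableD[OF yz]) auto
    moreover
    have "isomorphic (restriction R (insert x (insert z G))) (restriction R (insert y (insert z G)))"
      using G E ne by (intro exchangeableD[OF xy]) auto
    ultimately show ?thesis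
      unfolding F_eq by (metis insert_commute isomorphic_trans)
  qed
  then show ?thesis using E unfolding exchangeable_def by auto
qed

lemma equiv_exchangeable: "equiv (universe R) (exchangeable R)"
proof (rule equivI)
  show "exchangeable R \<subseteq> universe R \<times> universe R"
    by (auto simp: exchangeable_def)
  show "refl_on (universe R) (exchangeable R)"
    by (auto simp: refl_on_def exchangeable_def isomorphic_refl)
  show "sym (exchangeable R)"
    by (auto simp: sym_def exchangeable_def insert_commute intro: isomorphic_sym)
  show "trans (exchangeable R)"
    by (auto intro: transI exchangeable_trans)
qed

text \<open>
  The induction measures the distance from \<open>A\<close> to \<open>A'\<close> by the size of \<open>A - A'\<close>,
  which each exchange lowers by one.
\<close>

lemma isomorphic_if_same_class_sizes:
  assumes "finite A" "A \<subseteq> universe R" "finite A'" "A' \<subseteq> universe R"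
    and "\<forall>B\<in>universe R // exchangeable R. card (A \<inter> B) = card (A' \<inter> B)"
  shows "isomorphic (restriction R A) (restriction R A')"
  using assms
proof (induction "card (A - A')" arbitrary: A rule: less_induct)
  case less
  have class_eq: "A \<inter> B = A' \<inter> B"
    if "B \<in> universe R // exchangeable R" "A \<inter> B \<subseteq> A' \<inter> B \<or> A' \<inter> B \<subseteq> A \<inter> B" for B
    using that less.prems(1,3) less.prems(5)[rule_format, OF that(1)]
      card_subset_eq[of "A \<inter> B" "A' \<inter> B"] card_subset_eq[of "A' \<inter> B" "A \<inter> B"]
    by auto
  show ?case
  proof (cases "A \<subseteq> A'")
    case True
    have "A' \<subseteq> A"
    proof
      fix x assume "x \<in> A'"
      then have x: "x \<in> universe R" using less.prems by auto
      have "A \<inter> exchangeable R `` {x} = A' \<inter> exchangeable R `` {x}"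
        using True x by (intro class_eq quotientI) auto
      then show "x \<in> A" using \<open>x \<in> A'\<close> equiv_class_self[OF equiv_exchangeable x] by auto
    qed
    then show ?thesis using True by (simp add: isomorphic_refl subset_antisym)
  next
    case False
    then obtain x where x: "x \<in> A" "x \<notin> A'" by auto
    then have xE: "x \<in> universe R" using less.prems by auto
    define B where "B = exchangeable R `` {x}"
    have B: "B \<in> universe R // exchangeable R" "x \<in> B"
      unfolding B_def
      using quotientI[OF xE] equiv_class_self[OF equiv_exchangeable xE] by auto
    then obtain y where y: "y \<in> A'" "y \<notin> A" "y \<in> B"
      using class_eq[OF B(1)] x by blast
    have xy: "(x, y) \<in> exchangeable R" using y B_def by simp
    define F where "F = A - {x}"
    have F: "A = insert x F" "x \<notin> F" "y \<notin> F" "finite F" "F \<subseteq> universe R"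
      using x y less.prems by (auto simp: F_def)
    have "isomorphic (restriction R A) (restriction R (insert y F))"
      unfolding F(1) using exchangeableD[OF xy] F by auto
    moreover have "isomorphic (restriction R (insert y F)) (restriction R A')"
    proof (rule less.hyps)
      show "card (insert y F - A') < card (A - A')"
        using F x y by (intro psubset_card_mono) auto
      show "\<forall>C\<in>universe R // exchangeable R. card (insert y F \<inter> C) = card (A' \<inter> C)"
      proof
        fix C assume C: "C \<in> universe R // exchangeable R"
        have "x \<in> C \<longleftrightarrow> y \<in> C"
          using quotient_disj[OF equiv_exchangeable B(1) C] B(2) y(3) by auto
        then have "card (insert y F \<inter> C) = card (A \<inter> C)"
          using F by (auto simp: Int_insert_left)
        then show "card (insert y F \<inter> C) = card (A' \<inter> C)" using less.prems C by simp
      qed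
    qed (use F y less.prems in auto)
    ultimately show ?thesis by (rule isomorphic_trans)
  qed
qed

lemma exchangeability_classes_monomorphic:
  "monomorphic_decomposition R (universe R // exchangeable R)"
  unfolding monomorphic_decomposition_def
proof (intro conjI allI impI)
  show "partition_on (universe R) (universe R // exchangeable R)"
    by (rule partition_on_quotient[OF equiv_exchangeable])
qed (auto intro: isomorphic_if_same_class_sizes)

lemma same_block_exchangeable:
  assumes Q: "monomorphic_decomposition R Q" and C: "C \<in> Q" and x: "x \<in> C" and y: "y \<in> C"
  shows "(x, y) \<in> exchangeable R"
proof -
  have part: "partition_on (universe R) Q"
    using Q by (simp add: monomorphic_decomposition_def)
  then have E: "x \<in> universe R" "y \<in> universe R"
    using C x y by (auto simp: partition_on_def)
  have "isomorphic (restriction R (insert x F)) (restriction R (insert y F))"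
    if F: "finite F" "F \<subseteq> universe R - {x, y}" for F
  proof -
    have "card (insert x F \<inter> B) = card (insert y F \<inter> B)" if B: "B \<in> Q" for B
    proof -
      have "x \<in> B \<longleftrightarrow> y \<in> B"
        using part B C x y unfolding partition_on_def disjoint_def by blast
      moreover have "x \<notin> F" "y \<notin> F" using F by auto
      ultimately show ?thesis using F(1) by (simp add: Int_insert_left)
    qed
    moreover have "finite (insert x F)" "finite (insert y F)"
      "insert x F \<subseteq> universe R" "insert y F \<subseteq> universe R"
      using F E by auto
    ultimately show ?thesis
      using Q unfolding monomorphic_decomposition_def by blast
  qed
  then show ?thesis using E unfolding exchangeable_def by auto
qed

section \<open>The coarsest monomorphic decomposition\<close>

theorem proposition1p6:
  fixes R :: "('a, 'i) rel_struct"
  assumes "relational_structure R"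
  shows "\<exists>P. monomorphic_decomposition R P \<and>
             (\<forall>Q. monomorphic_decomposition R Q \<longrightarrow> refines (universe R) Q P)"
proof (intro exI conjI allI impI)
  show "monomorphic_decomposition R (universe R // exchangeable R)"
    by (rule exchangeability_classes_monomorphic)
  fix Q assume Q: "monomorphic_decomposition R Q"
  have part: "partition_on (universe R) Q"
    using Q by (simp add: monomorphic_decomposition_def)
  have "\<exists>B\<in>universe R // exchangeable R. C \<subseteq> B" if C: "C \<in> Q" for C
  proof -
    have "C \<noteq> {}" using C partition_onD3[OF part] by metis
    then obtain x where x: "x \<in> C" by auto
    have xE: "x \<in> universe R" using x C partition_onD1[OF part] by simp blast
    have "C \<subseteq> exchangeable R `` {x}"
      using same_block_exchangeable[OF Q C x] by auto
    then show ?thesis using quotientI[OF xE] by (rule bexI)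
  qed
  then show "refines (universe R) Q (universe R // exchangeable R)"
    using part partition_on_quotient[OF equiv_exchangeable[of R]] by (simp add: refines_def)
qed

end
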